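(* Let $d, m$ be positive integers, $1>\delta > 0$ and $n = \left\lfloor 4d^2(m-1)c_{\delta}^{-1}\right\rfloor+1$. Given a family $\mathcal{T} = \{T_1, T_2, \ldots, T_{n}\}$ of sets in $\mathbb{R}^d$ of diameter greater than or equal to one each, there is a partition of $\mathcal{T}$ into $m$ parts $A_1, A_2, \ldots, A_m$ so that \[ \operatorname{diam} \left(\bigcap_{i=1}^m \operatorname{conv}\left(\bigcup A_i\right)\right) \ge 1- \delta . \]
   Context: The diameter $\operatorname{diam}(X)$ of a set $X\subset\mathbb{R}^d$ is the supremum of Euclidean distances between two of its points; the empty set does not have diameter at least any positive number. $\bigcup A_i$ denotes the union of all the sets $T_j$ belonging to the part $A_i$, and $\operatorname{conv}$ denotes convex hull. $c_\delta$ (depending on $d$ and $\delta$) is the measure, under the rotation-invariant probability (Haar) measure on the unit sphere $S^{d-1}\subset\mathbb{R}^d$, of a cap $C_\delta(x)=\{y\in S^{d-1}:\langle x,y\rangle\ge 1-\delta\}$, for any $x\in S^{d-1}$ (the value does not depend on $x$). *)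

theory Defs
  imports "HOL-Probability.Probability"
begin

section \<open>The rotation-invariant probability measure on the unit sphere\<close>

text \<open>
  Invariance is required under all of \<open>O(d)\<close>. For \<open>d \<ge> 2\<close> invariance under
  \<open>SO(d)\<close> already determines the measure; for \<open>d = 1\<close> the group \<open>SO(1)\<close> is trivial and
  the reflection is needed to single out the uniform measure on \<open>{-1, 1}\<close>.
\<close>

definition rotation_invariant_prob :: "(real^'d) measure \<Rightarrow> bool" where
  "rotation_invariant_prob \<sigma> \<longleftrightarrow>
     prob_space \<sigma> \<and>
     sets \<sigma> = sets (restrict_space borel (sphere 0 1)) \<and>
     (\<forall>f. orthogonal_transformation f \<longrightarrow> distr \<sigma> \<sigma> f = \<sigma>)"

text \<open>Existence and uniqueness are shown in \<open>ex1_rotation_invariant_prob\<close> below.\<close>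

definition haar_sphere :: "(real^'d) measure" where
  "haar_sphere = (THE \<sigma>. rotation_invariant_prob \<sigma>)"

definition sphere_cap :: "real \<Rightarrow> real^'d \<Rightarrow> (real^'d) set" where
  "sphere_cap \<delta> x = {y \<in> sphere 0 1. x \<bullet> y \<ge> 1 - \<delta>}"

text \<open>
  The number \<open>c\<^sub>\<delta>\<close>; the dimension is passed as a type. The choice of the centre is immaterial
  by \<open>cap_measure_eq\<close> below.
\<close>

definition cap_measure :: "'d::finite itself \<Rightarrow> real \<Rightarrow> real" where
  "cap_measure _ \<delta> = measure haar_sphere (sphere_cap \<delta> (SOME x::real^'d. x \<in> sphere 0 1))"


section \<open>Diameter\<close>

text \<open>
  The diameter takes values in \<open>[0, \<infinity>]\<close>, because the library's real-valued
  \<^const>\<open>diameter\<close> is only meaningful for bounded sets. The diameter of the empty set is 0.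
\<close>

definition ediameter :: "'a::metric_space set \<Rightarrow> ennreal" where
  "ediameter S = (SUP (x, y) \<in> S \<times> S. ennreal (dist x y))"

lemma ediameter_empty: "ediameter {} = 0"
  by (simp add: ediameter_def bot_ennreal)

lemma ediameter_bounded:
  assumes "bounded S"
  shows "ediameter S = ennreal (diameter S)"
proof (cases "S = {}")
  case True
  then show ?thesis by (simp add: ediameter_def bot_ennreal)
next
  case False
  show ?thesis
  proof (rule antisym)
    show "ediameter S \<le> ennreal (diameter S)"
      unfolding ediameter_def
      by (rule SUP_least) (auto intro!: ennreal_leI diameter_bounded_bound assms)
    have *: "ennreal (dist x y) \<le> ediameter S" if "x \<in> S" "y \<in> S" for x y
      unfolding ediameter_def by (rule SUP_upper2[of "(x, y)"]) (use that in auto)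
    show "ennreal (diameter S) \<le> ediameter S"
    proof (cases "ediameter S")
      case (real r)
      have "diameter S \<le> r"
        unfolding diameter_def using False
        by (auto intro!: cSUP_least) (use * real in fastforce)
      then show ?thesis using real by (simp add: ennreal_leI)
    qed simp
  qed
qed


section \<open>Well-definedness of the Haar measure and of the cap measure\<close>

text \<open>Two measures that give all balls of the same radius the same mass coincide (Christensen).\<close>

lemma uniformly_distributed_open_le:
  fixes M N :: "'a::euclidean_space measure"
  assumes sM: "sets M = sets (restrict_space borel S)"
    and sN: "sets N = sets (restrict_space borel S)"
    and "sigma_finite_measure M" "sigma_finite_measure N"
    and hM: "\<And>x r. x \<in> S \<Longrightarrow> r > 0 \<Longrightarrow> emeasure M (ball x r \<inter> S) = h r"
    and hN: "\<And>x r. x \<in> S \<Longrightarrow> r > 0 \<Longrightarrow> emeasure N (ball x r \<inter> S) = h r"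
    and h: "\<And>r. r > 0 \<Longrightarrow> h r \<noteq> 0 \<and> h r \<noteq> \<infinity>"
    and U: "open U"
  shows "emeasure N (U \<inter> S) \<le> emeasure M (U \<inter> S)"
proof -
  interpret M: sigma_finite_measure M by fact
  interpret N: sigma_finite_measure N by fact
  interpret NM: pair_sigma_finite N M ..
  have spM: "space M = S" and spN: "space N = S"
    using sets_eq_imp_space_eq[OF sM] sets_eq_imp_space_eq[OF sN] by (auto simp: space_restrict_space)
  have idM [measurable]: "(\<lambda>x. x) \<in> M \<rightarrow>\<^sub>M borel" and idN [measurable]: "(\<lambda>x. x) \<in> N \<rightarrow>\<^sub>M borel"
    by (auto simp: measurable_cong_sets[OF sM refl] measurable_cong_sets[OF sN refl]
             intro!: measurable_restrict_space1)
  have mS: "A \<inter> S \<in> sets M" "A \<inter> S \<in> sets N" if "open A" for A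
    using that by (auto simp: sM sN sets_restrict_space)
  define Q where "Q r = {p \<in> space (N \<Otimes>\<^sub>M M). snd p \<in> U \<and> dist (fst p) (snd p) < r}" for r :: real
  have U' [measurable]: "U \<in> sets borel" using U by simp
  have [measurable]: "fst \<in> N \<Otimes>\<^sub>M M \<rightarrow>\<^sub>M borel" "snd \<in> N \<Otimes>\<^sub>M M \<rightarrow>\<^sub>M borel"
    using measurable_compose[OF measurable_fst idN] measurable_compose[OF measurable_snd idM]
    by auto
  have Q: "Q r \<in> sets (N \<Otimes>\<^sub>M M)" for r
    unfolding Q_def by measurable
  have Q1: "Pair x -` Q r = (U \<inter> ball x r) \<inter> S" if "x \<in> S" for x r
    using that by (auto simp: Q_def space_pair_measure spM spN)
  have Q2: "(\<lambda>x. (x, y)) -` Q r = (if y \<in> U then ball y r \<inter> S else {})" if "y \<in> S" for y r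
    using that by (auto simp: Q_def space_pair_measure spM spN dist_commute)
  have key: "(\<integral>\<^sup>+x. emeasure M ((U \<inter> ball x r) \<inter> S) / h r \<partial>N) = emeasure M (U \<inter> S)" if "r > 0" for r
  proof -
    have "(\<integral>\<^sup>+x. emeasure M ((U \<inter> ball x r) \<inter> S) / h r \<partial>N)
        = (\<integral>\<^sup>+x. emeasure M (Pair x -` Q r) / h r \<partial>N)"
      by (rule nn_integral_cong) (simp add: Q1 spN)
    also have "\<dots> = (\<integral>\<^sup>+x. emeasure M (Pair x -` Q r) \<partial>N) / h r"
      by (rule nn_integral_divide) (rule NM.measurable_emeasure_Pair1[OF Q])
    also have "(\<integral>\<^sup>+x. emeasure M (Pair x -` Q r) \<partial>N) = emeasure (N \<Otimes>\<^sub>M M) (Q r)"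
      by (rule M.emeasure_pair_measure_alt[OF Q, symmetric])
    also have "\<dots> = (\<integral>\<^sup>+y. emeasure N ((\<lambda>x. (x, y)) -` Q r) \<partial>M)"
      by (rule NM.emeasure_pair_measure_alt2[OF Q])
    also have "\<dots> = (\<integral>\<^sup>+y. h r * indicator (U \<inter> S) y \<partial>M)"
      by (rule nn_integral_cong) (use that in \<open>auto simp: Q2 spM hN indicator_def\<close>)
    also have "\<dots> = h r * emeasure M (U \<inter> S)"
      by (rule nn_integral_cmult_indicator) (rule mS[OF U])
    finally show ?thesis
      using h[OF that] by (simp add: mult_divide_eq_ennreal mult.commute[of "h r"])
  qed
  define g where "g i x = emeasure M ((U \<inter> ball x (inverse (real (Suc i)))) \<inter> S) / h (inverse (real (Suc i)))"
    for i x
  have g_meas: "g i \<in> borel_measurable N" for i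
  proof -
    have "(\<lambda>x. emeasure M (Pair x -` Q (inverse (real (Suc i)))) / h (inverse (real (Suc i))))
            \<in> borel_measurable N"
      using NM.measurable_emeasure_Pair1[OF Q] by measurable
    also have "?this \<longleftrightarrow> ?thesis"
      by (rule measurable_cong) (simp add: Q1 spN g_def)
    finally show ?thesis .
  qed
  have "emeasure N (U \<inter> S) = (\<integral>\<^sup>+x. indicator (U \<inter> S) x \<partial>N)"
    using mS[OF U] by simp
  also have "\<dots> \<le> (\<integral>\<^sup>+x. liminf (\<lambda>i. g i x) \<partial>N)"
  proof (rule nn_integral_mono)
    fix x assume "x \<in> space N"
    show "indicator (U \<inter> S) x \<le> liminf (\<lambda>i. g i x)"
    proof (cases "x \<in> U \<inter> S")
      case True
      then obtain e where e: "e > 0" "ball x e \<subseteq> U"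
        using U by (meson IntD1 openE)
      have "\<forall>\<^sub>F i in sequentially. inverse (real (Suc i)) < e"
        using LIMSEQ_inverse_real_of_nat e(1) by (rule order_tendstoD)
      then have "\<forall>\<^sub>F i in sequentially. 1 \<le> g i x"
      proof eventually_elim
        case (elim i)
        have r: "inverse (real (Suc i)) > 0" by simp
        have "U \<inter> ball x (inverse (real (Suc i))) = ball x (inverse (real (Suc i)))"
          using e(2) elim by (auto simp: subset_eq)
        then show ?case
          using True h[OF r] hM[OF _ r, of x]
          by (simp add: g_def less_top)
      qed
      then have "1 \<le> liminf (\<lambda>i. g i x)" by (rule Liminf_bounded)
      then show ?thesis using True by simp
    qed simp
  qed
  also have "\<dots> \<le> liminf (\<lambda>i. \<integral>\<^sup>+x. g i x \<partial>N)"
    by (rule nn_integral_liminf) (rule g_meas)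
  also have "(\<lambda>i. \<integral>\<^sup>+x. g i x \<partial>N) = (\<lambda>i. emeasure M (U \<inter> S))"
    unfolding g_def by (intro ext key) simp
  finally show ?thesis by (simp add: Liminf_const)
qed

lemma uniformly_distributed_unique:
  fixes M N :: "'a::euclidean_space measure"
  assumes sM: "sets M = sets (restrict_space borel S)"
    and sN: "sets N = sets (restrict_space borel S)"
    and sf: "sigma_finite_measure M" "sigma_finite_measure N"
    and hM: "\<And>x r. x \<in> S \<Longrightarrow> r > 0 \<Longrightarrow> emeasure M (ball x r \<inter> S) = h r"
    and hN: "\<And>x r. x \<in> S \<Longrightarrow> r > 0 \<Longrightarrow> emeasure N (ball x r \<inter> S) = h r"
    and h: "\<And>r. r > 0 \<Longrightarrow> h r \<noteq> 0 \<and> h r \<noteq> \<infinity>"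
    and ne: "S \<noteq> {}" and S: "S \<in> sets borel"
  shows "M = N"
proof -
  obtain a where a: "a \<in> S" using ne by blast
  define E where "E = (\<inter>) S ` {U. open U}"
  have gen: "sets (restrict_space borel S) = sigma_sets S E"
    unfolding E_def sets_restrict_space sets_borel by (rule sigma_sets_Int) (use S in \<open>simp_all add: sets_borel\<close>)
  show ?thesis
  proof (rule measure_eqI_generator_eq[where E = E and \<Omega> = S and A = "\<lambda>i. S \<inter> ball a (real (Suc i))"])
    show "Int_stable E"
    proof (rule Int_stableI)
      fix A B assume "A \<in> E" "B \<in> E"
      then obtain U V where "open U" "open V" "A = S \<inter> U" "B = S \<inter> V" by (auto simp: E_def)
      then have "A \<inter> B = S \<inter> (U \<inter> V)" "open (U \<inter> V)" by auto
      then show "A \<inter> B \<in> E" unfolding E_def by blast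
    qed
    show "E \<subseteq> Pow S" by (auto simp: E_def)
    show "emeasure M X = emeasure N X" if "X \<in> E" for X
    proof -
      obtain U where U: "open U" "X = U \<inter> S" using \<open>X \<in> E\<close> by (auto simp: E_def)
      show ?thesis unfolding U(2)
        using uniformly_distributed_open_le[OF sM sN sf hM hN h U(1)]
          uniformly_distributed_open_le[OF sN sM sf(2,1) hN hM h U(1)]
        by (intro antisym) auto
    qed
    show "sets M = sigma_sets S E" "sets N = sigma_sets S E" using sM sN gen by auto
    show "range (\<lambda>i. S \<inter> ball a (real (Suc i))) \<subseteq> E" by (auto simp: E_def)
    show "(\<Union>i. S \<inter> ball a (real (Suc i))) = S"
    proof -
      have "\<exists>i. dist a x < 1 + real i" for x
        using reals_Archimedean2[of "dist a x"] by (metis add.commute less_add_one order_less_trans)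
      then show ?thesis by auto
    qed
    show "emeasure M (S \<inter> ball a (real (Suc i))) \<noteq> \<infinity>" for i
      using hM[OF a, of "real (Suc i)"] h[of "real (Suc i)"] by (simp add: Int_commute)
  qed
qed

lemma distr_lborel_orthogonal:
  fixes f :: "'a::euclidean_space \<Rightarrow> 'a"
  assumes f: "orthogonal_transformation f"
  shows "distr lborel borel f = lborel"
proof -
  have lin: "linear f" using f by (rule orthogonal_transformation_linear)
  have [measurable]: "f \<in> borel \<rightarrow>\<^sub>M borel"
    using linear_continuous_on[OF linear_conv_bounded_linear[THEN iffD1, OF lin]]
    by (rule borel_measurable_continuous_onI)
  have surj: "surj f" and inj: "inj f"
    using orthogonal_transformation_surj[OF f] orthogonal_transformation_inj[OF f] by auto
  define h where "h r = emeasure lborel (ball (0::'a) r)" for r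
  have hl: "emeasure lborel (ball x r) = h r" if "r > 0" for x :: 'a and r
    using that by (simp add: h_def emeasure_ball)
  have pre: "f -` ball x r = ball (inv f x) r" for x r
  proof -
    have "ball x r = f ` ball (inv f x) r"
      using image_orthogonal_transformation_ball[OF f, of "inv f x" r] surj by (simp add: surj_f_inv_f)
    then show ?thesis by (simp only: inj_vimage_image_eq[OF inj])
  qed
  have hd: "emeasure (distr lborel borel f) (ball x r) = h r" if "r > 0" for x r
    using that by (simp add: emeasure_distr pre hl)
  have hpos: "h r \<noteq> 0 \<and> h r \<noteq> \<infinity>" if "r > 0" for r
    using that by (simp add: h_def emeasure_ball less_imp_neq[OF unit_ball_vol_pos, symmetric])
  have sf: "sigma_finite_measure (distr lborel borel f)"
  proof
    have "emeasure (distr lborel borel f) (ball 0 (real (Suc i))) \<noteq> \<infinity>" for i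
      using hd[of "real (Suc i)" 0] hpos[of "real (Suc i)"] by simp
    moreover have "(\<Union>i. ball (0::'a) (real (Suc i))) = UNIV"
    proof -
      have "\<exists>i. norm x < 1 + real i" for x :: 'a
        using reals_Archimedean2[of "norm x"] by (metis add.commute less_add_one order_less_trans)
      then show ?thesis by auto
    qed
    ultimately show "\<exists>A. countable A \<and> A \<subseteq> sets (distr lborel borel f) \<and>
        \<Union> A = space (distr lborel borel f) \<and> (\<forall>a\<in>A. emeasure (distr lborel borel f) a \<noteq> \<infinity>)"
      by (intro exI[of _ "range (\<lambda>i. ball 0 (real (Suc i)))"]) auto
  qed
  show ?thesis
    by (rule uniformly_distributed_unique[where S = UNIV and h = h])
      (use hpos in \<open>simp_all add: hl hd sf sigma_finite_lborel\<close>)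
qed

lemma orthogonal_vimage_ball_sphere:
  fixes f :: "'a::euclidean_space \<Rightarrow> 'a"
  assumes "orthogonal_transformation f"
  shows "f -` (ball (f x) r \<inter> sphere 0 1) \<inter> sphere 0 1 = ball x r \<inter> sphere 0 1"
proof -
  have "dist (f x) (f y) = dist x y" for y
    using assms by (simp add: orthogonal_transformation_isometry)
  then show ?thesis using orthogonal_transformation_norm[OF assms] by auto
qed

lemma orthogonal_measurable_sphere:
  fixes f :: "real^'d \<Rightarrow> real^'d"
  assumes "orthogonal_transformation f" "sets \<sigma> = sets (restrict_space borel (sphere 0 1))"
  shows "f \<in> \<sigma> \<rightarrow>\<^sub>M \<sigma>"
proof -
  have "f \<in> borel \<rightarrow>\<^sub>M borel"
    using linear_continuous_on[OF linear_conv_bounded_linear[THEN iffD1,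
          OF orthogonal_transformation_linear[OF assms(1)]]]
    by (rule borel_measurable_continuous_onI)
  then have "f \<in> restrict_space borel (sphere 0 1) \<rightarrow>\<^sub>M restrict_space borel (sphere 0 1)"
    by (rule measurable_restrict_space3) (simp add: orthogonal_transformation_norm[OF assms(1)])
  then show ?thesis using measurable_cong_sets[OF assms(2) assms(2)] by blast
qed

lemma rotation_invariant_prob_emeasure_vimage:
  fixes \<sigma> :: "(real^'d) measure"
  assumes \<sigma>: "rotation_invariant_prob \<sigma>" and f: "orthogonal_transformation f" and A: "A \<in> sets \<sigma>"
  shows "emeasure \<sigma> (f -` A \<inter> sphere 0 1) = emeasure \<sigma> A"
proof -
  have s: "sets \<sigma> = sets (restrict_space borel (sphere 0 1))" and d: "distr \<sigma> \<sigma> f = \<sigma>"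
    using \<sigma> f by (auto simp: rotation_invariant_prob_def)
  have "space \<sigma> = sphere 0 1"
    using sets_eq_imp_space_eq[OF s] by (simp add: space_restrict_space)
  then show ?thesis
    using emeasure_distr[OF orthogonal_measurable_sphere[OF f s] A] d by simp
qed

lemma sphere_transitive:
  fixes x y :: "real^'d"
  assumes "x \<in> sphere 0 1" "y \<in> sphere 0 1"
  obtains f where "orthogonal_transformation f" "f x = y"
proof -
  have "norm x = norm y" using assms by simp
  then show thesis using that by (rule orthogonal_transformation_exists)
qed

lemma rotation_invariant_prob_ball_eq:
  fixes e :: "real^'d"
  assumes \<mu>: "rotation_invariant_prob \<mu>" and e: "e \<in> sphere 0 1" and x: "x \<in> sphere 0 1"
  shows "emeasure \<mu> (ball e r \<inter> sphere 0 1) = emeasure \<mu> (ball x r \<inter> sphere 0 1)"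
proof -
  obtain f where f: "orthogonal_transformation f" "f e = x" using sphere_transitive[OF e x] .
  have "ball x r \<inter> sphere 0 1 \<in> sets \<mu>"
    using \<mu> by (auto simp: rotation_invariant_prob_def sets_restrict_space)
  from rotation_invariant_prob_emeasure_vimage[OF \<mu> f(1) this] show ?thesis
    using orthogonal_vimage_ball_sphere[OF f(1), of e r] f(2) by simp
qed

lemma rotation_invariant_prob_ball_pos:
  fixes e :: "real^'d"
  assumes \<mu>: "rotation_invariant_prob \<mu>" and e: "e \<in> sphere 0 1" and r: "r > 0"
  shows "0 < emeasure \<mu> (ball e r \<inter> sphere 0 1)"
proof (rule ccontr)
  let ?S = "sphere 0 1 :: (real^'d) set"
  assume "\<not> ?thesis"
  then have 0: "emeasure \<mu> (ball x r \<inter> ?S) = 0" if "x \<in> ?S" for x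
    using rotation_invariant_prob_ball_eq[OF \<mu> e that] by (simp add: not_gr_zero)
  obtain K where K: "K \<subseteq> ?S" "finite K" "?S \<subseteq> (\<Union>x\<in>K. ball x r)"
  proof (rule compactE_image[OF compact_sphere, of ?S "\<lambda>x. ball x r" 0 1])
    show "?S \<subseteq> (\<Union>x\<in>?S. ball x r)" using r by auto
  qed auto
  have "ball x r \<inter> ?S \<in> null_sets \<mu>" if "x \<in> K" for x
    using 0 K(1) that \<mu> by (auto simp: null_sets_def rotation_invariant_prob_def sets_restrict_space)
  then have "(\<Union>x\<in>K. ball x r \<inter> ?S) \<in> null_sets \<mu>"
    using K(2) by (intro null_sets_UN') (auto intro: countable_finite)
  moreover have "(\<Union>x\<in>K. ball x r \<inter> ?S) = ?S" using K(3) by auto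
  moreover have "space \<mu> = ?S"
    using \<mu> sets_eq_imp_space_eq[of \<mu> "restrict_space borel ?S"]
    by (auto simp: rotation_invariant_prob_def space_restrict_space)
  ultimately show False
    using \<mu> prob_space.emeasure_space_1[of \<mu>] by (auto simp: rotation_invariant_prob_def null_sets_def)
qed

lemma rotation_invariant_prob_unique:
  fixes \<sigma> \<tau> :: "(real^'d) measure"
  assumes \<sigma>: "rotation_invariant_prob \<sigma>" and \<tau>: "rotation_invariant_prob \<tau>"
  shows "\<sigma> = \<tau>"
proof -
  let ?S = "sphere 0 1 :: (real^'d) set"
  define e :: "real^'d" where "e = axis undefined 1"
  have e: "e \<in> ?S" by (simp add: e_def)
  have balls: "emeasure \<mu> (ball x r \<inter> ?S) = emeasure \<mu> (ball e r \<inter> ?S)"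
    if "rotation_invariant_prob \<mu>" "x \<in> ?S" for \<mu> x r
    using that(1) e that(2) by (rule rotation_invariant_prob_ball_eq[symmetric])
  have pos: "0 < emeasure \<mu> (ball e r \<inter> ?S)"
    if "rotation_invariant_prob \<mu>" "r > 0" for \<mu> r
    using that(1) e that(2) by (rule rotation_invariant_prob_ball_pos)
  have fin: "finite_measure \<sigma>" "finite_measure \<tau>" and ps: "prob_space \<sigma>" "prob_space \<tau>"
    using \<sigma> \<tau> by (auto simp: rotation_invariant_prob_def prob_space_def)
  have sf: "sigma_finite_measure \<sigma>" "sigma_finite_measure \<tau>"
    using fin by (auto simp: finite_measure_def)
  have s: "sets \<sigma> = sets (restrict_space borel ?S)" "sets \<tau> = sets (restrict_space borel ?S)"
    using \<sigma> \<tau> by (auto simp: rotation_invariant_prob_def)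
  have sp: "space \<sigma> = ?S" "space \<tau> = ?S"
    using s[THEN sets_eq_imp_space_eq] by (auto simp: space_restrict_space)
  have eq: "emeasure \<sigma> (ball e r \<inter> ?S) = emeasure \<tau> (ball e r \<inter> ?S)" for r
  proof -
    interpret S: sigma_finite_measure \<sigma> by (rule sf)
    interpret T: sigma_finite_measure \<tau> by (rule sf)
    interpret ST: pair_sigma_finite \<sigma> \<tau> ..
    define Q where "Q = {p \<in> space (\<sigma> \<Otimes>\<^sub>M \<tau>). dist (fst p) (snd p) < r}"
    have "(\<lambda>x. x) \<in> \<sigma> \<rightarrow>\<^sub>M borel" "(\<lambda>x. x) \<in> \<tau> \<rightarrow>\<^sub>M borel"
      by (auto simp: measurable_cong_sets[OF s(1) refl] measurable_cong_sets[OF s(2) refl]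
               intro!: measurable_restrict_space1)
    then have [measurable]: "fst \<in> \<sigma> \<Otimes>\<^sub>M \<tau> \<rightarrow>\<^sub>M borel" "snd \<in> \<sigma> \<Otimes>\<^sub>M \<tau> \<rightarrow>\<^sub>M borel"
      using measurable_compose[OF measurable_fst] measurable_compose[OF measurable_snd] by auto
    have Q: "Q \<in> sets (\<sigma> \<Otimes>\<^sub>M \<tau>)" unfolding Q_def by measurable
    have Q1: "Pair x -` Q = ball x r \<inter> ?S" if "x \<in> ?S" for x
      using that by (auto simp: Q_def space_pair_measure sp)
    have Q2: "(\<lambda>x. (x, y)) -` Q = ball y r \<inter> ?S" if "y \<in> ?S" for y
      using that by (auto simp: Q_def space_pair_measure sp dist_commute)
    have "emeasure \<tau> (ball e r \<inter> ?S) = (\<integral>\<^sup>+x. emeasure \<tau> (ball e r \<inter> ?S) \<partial>\<sigma>)"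
      using prob_space.emeasure_space_1[OF ps(1)] by simp
    also have "\<dots> = (\<integral>\<^sup>+x. emeasure \<tau> (Pair x -` Q) \<partial>\<sigma>)"
      by (rule nn_integral_cong) (simp only: sp Q1 balls[OF \<tau>])
    also have "\<dots> = (\<integral>\<^sup>+y. emeasure \<sigma> ((\<lambda>x. (x, y)) -` Q) \<partial>\<tau>)"
      using T.emeasure_pair_measure_alt[OF Q] ST.emeasure_pair_measure_alt2[OF Q] by simp
    also have "\<dots> = (\<integral>\<^sup>+y. emeasure \<sigma> (ball e r \<inter> ?S) \<partial>\<tau>)"
      by (rule nn_integral_cong) (simp only: sp Q2 balls[OF \<sigma>])
    also have "\<dots> = emeasure \<sigma> (ball e r \<inter> ?S)"
      using prob_space.emeasure_space_1[OF ps(2)] by simp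
    finally show ?thesis by simp
  qed
  show ?thesis
  proof (rule uniformly_distributed_unique[where h = "\<lambda>r. emeasure \<sigma> (ball e r \<inter> ?S)", OF s sf])
    show "emeasure \<sigma> (ball e r \<inter> ?S) \<noteq> 0 \<and> emeasure \<sigma> (ball e r \<inter> ?S) \<noteq> \<infinity>" if "r > 0" for r
      using pos[OF \<sigma> that] finite_measure.emeasure_finite[OF fin(1)] by auto
    show "emeasure \<sigma> (ball x r \<inter> ?S) = emeasure \<sigma> (ball e r \<inter> ?S)" if "x \<in> ?S" for x r
      by (rule balls[OF \<sigma> that])
    show "emeasure \<tau> (ball x r \<inter> ?S) = emeasure \<sigma> (ball e r \<inter> ?S)" if "x \<in> ?S" for x r
      unfolding eq by (rule balls[OF \<tau> that])
    show "?S \<noteq> {}" using e by blast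
  qed simp
qed

text \<open>Existence: push the uniform measure on the unit ball forward along the radial projection.\<close>

lemma rotation_invariant_prob_exists: "\<exists>\<sigma> :: (real^'d) measure. rotation_invariant_prob \<sigma>"
proof -
  let ?S = "sphere 0 1 :: (real^'d) set"
  define e :: "real^'d" where "e = axis undefined 1"
  define B :: "(real^'d) measure" where "B = uniform_measure lborel (ball 0 1)"
  define R where "R = restrict_space borel ?S"
  define g :: "real^'d \<Rightarrow> real^'d" where "g x = (if x = 0 then e else x /\<^sub>R norm x)" for x
  have sB [measurable_cong]: "sets B = sets borel" by (simp add: B_def)
  have spB: "space B = UNIV" by (simp add: B_def)
  have g0 [measurable]: "g \<in> borel \<rightarrow>\<^sub>M borel" unfolding g_def by measurable
  have g [measurable]: "g \<in> B \<rightarrow>\<^sub>M R"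
    unfolding R_def by (rule measurable_restrict_space2) (auto simp: g_def e_def)
  have prob_B: "prob_space B"
    unfolding B_def by (rule prob_space_uniform_measure)
      (simp_all add: emeasure_ball less_imp_neq[OF unit_ball_vol_pos, symmetric])
  define \<sigma> where "\<sigma> = distr B R g"
  have s: "sets \<sigma> = sets R" by (simp add: \<sigma>_def)
  have B_inv: "distr B borel f = B" if f: "orthogonal_transformation f" for f
  proof (rule measure_eqI)
    have [measurable]: "f \<in> borel \<rightarrow>\<^sub>M borel"
      using linear_continuous_on[OF linear_conv_bounded_linear[THEN iffD1,
            OF orthogonal_transformation_linear[OF f]]]
      by (rule borel_measurable_continuous_onI)
    have fB: "f \<in> B \<rightarrow>\<^sub>M borel" by measurable
    fix A assume "A \<in> sets (distr B borel f)"
    then have A [measurable]: "A \<in> sets borel" by simp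
    have pre: "f -` A \<in> sets borel" using measurable_sets[OF \<open>f \<in> borel \<rightarrow>\<^sub>M borel\<close> A] by simp
    have "emeasure lborel (ball 0 1 \<inter> f -` A) = emeasure (distr lborel borel f) (ball 0 1 \<inter> A)"
      by (subst emeasure_distr)
        (auto intro!: arg_cong[where f = "emeasure lborel"] simp: orthogonal_transformation_norm[OF f])
    then have "emeasure lborel (ball 0 1 \<inter> f -` A) = emeasure lborel (ball 0 1 \<inter> A)"
      using distr_lborel_orthogonal[OF f] by simp
    then show "emeasure (distr B borel f) A = emeasure B A"
      using emeasure_distr[OF fB A] pre by (simp add: spB) (simp add: B_def)
  qed (simp add: sB)
  have "distr \<sigma> \<sigma> f = \<sigma>" if f: "orthogonal_transformation f" for f
  proof -
    have fR: "f \<in> R \<rightarrow>\<^sub>M R"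
      by (rule orthogonal_measurable_sphere[OF f]) (simp add: R_def)
    have fb [measurable]: "f \<in> borel \<rightarrow>\<^sub>M borel"
      using linear_continuous_on[OF linear_conv_bounded_linear[THEN iffD1,
            OF orthogonal_transformation_linear[OF f]]]
      by (rule borel_measurable_continuous_onI)
    have fB: "f \<in> B \<rightarrow>\<^sub>M borel" by measurable
    have gb: "g \<in> borel \<rightarrow>\<^sub>M R" using g measurable_cong_sets[OF sB refl] by blast
    have "AE x in B. x \<noteq> 0"
      unfolding B_def
      by (rule AE_uniform_measureI) (use AE_lborel_singleton[of "0::real^'d"] in auto)
    then have ae: "AE x in B. (f \<circ> g) x = (g \<circ> f) x"
    proof eventually_elim
      case (elim x)
      have "norm (f x) = norm x" using f by (rule orthogonal_transformation_norm)
      then have "f x \<noteq> 0" using elim by (metis norm_eq_zero)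
      then show ?case
        using elim \<open>norm (f x) = norm x\<close> orthogonal_transformation_scaleR[OF f] by (simp add: g_def)
    qed
    have "distr \<sigma> \<sigma> f = distr (distr B R g) R f"
      unfolding \<sigma>_def by (rule distr_cong) auto
    also have "\<dots> = distr B R (f \<circ> g)" by (rule distr_distr[OF fR g])
    also have "\<dots> = distr B R (g \<circ> f)"
      by (rule distr_cong_AE[OF refl refl ae]) (use g fR gb fB in \<open>auto intro: measurable_comp\<close>)
    also have "\<dots> = distr (distr B borel f) R g" by (rule distr_distr[OF gb fB, symmetric])
    also have "\<dots> = \<sigma>" by (simp add: B_inv[OF f] \<sigma>_def)
    finally show ?thesis .
  qed
  moreover have "prob_space \<sigma>"
    unfolding \<sigma>_def by (rule prob_space.prob_space_distr[OF prob_B g])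
  ultimately have "rotation_invariant_prob \<sigma>"
    using s by (simp add: rotation_invariant_prob_def R_def)
  then show ?thesis ..
qed

theorem ex1_rotation_invariant_prob: "\<exists>!\<sigma> :: (real^'d) measure. rotation_invariant_prob \<sigma>"
  using rotation_invariant_prob_exists rotation_invariant_prob_unique by blast

corollary rotation_invariant_prob_haar_sphere:
  "rotation_invariant_prob (haar_sphere :: (real^'d) measure)"
  unfolding haar_sphere_def by (rule theI'[OF ex1_rotation_invariant_prob])

lemma sphere_cap_in_sets: "sphere_cap \<delta> x \<in> sets (haar_sphere :: (real^'d) measure)"
proof -
  have "sphere_cap \<delta> x = sphere 0 1 \<inter> {y. x \<bullet> y \<ge> 1 - \<delta>}" by (auto simp: sphere_cap_def)
  moreover have "{y. x \<bullet> y \<ge> 1 - \<delta>} \<in> sets borel" by (simp add: closed_halfspace_ge)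
  moreover have "sets (haar_sphere :: (real^'d) measure) = sets (restrict_space borel (sphere 0 1))"
    using rotation_invariant_prob_haar_sphere unfolding rotation_invariant_prob_def by blast
  ultimately show ?thesis
    by (simp add: sets_restrict_space)
qed

theorem cap_measure_eq:
  fixes x :: "real^'d"
  assumes x: "x \<in> sphere 0 1"
  shows "measure haar_sphere (sphere_cap \<delta> x) = cap_measure TYPE('d) \<delta>"
proof -
  define z :: "real^'d" where "z = (SOME x. x \<in> sphere 0 1)"
  have z: "z \<in> sphere 0 1" unfolding z_def by (rule someI[of "\<lambda>x. x \<in> sphere 0 1", OF x])
  obtain f where f: "orthogonal_transformation f" "f z = x" using sphere_transitive[OF z x] .
  have "f z \<bullet> f y = z \<bullet> y" for y using f(1) by (simp add: orthogonal_transformation_def)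
  then have "f -` sphere_cap \<delta> x \<inter> sphere 0 1 = sphere_cap \<delta> z"
    using f orthogonal_transformation_norm[OF f(1)] by (auto simp: sphere_cap_def)
  with rotation_invariant_prob_emeasure_vimage[OF rotation_invariant_prob_haar_sphere f(1)
      sphere_cap_in_sets, of \<delta> x]
  show ?thesis unfolding cap_measure_def z_def[symmetric] measure_def by simp
qed

lemma cap_measure_pos:
  assumes \<delta>: "\<delta> > 0"
  shows "cap_measure TYPE('d::finite) \<delta> > 0"
proof -
  define e :: "real^'d" where "e = axis undefined 1"
  have e: "e \<in> sphere 0 1" by (simp add: e_def)
  let ?H = "haar_sphere :: (real^'d) measure"
  have rot: "rotation_invariant_prob ?H" by (rule rotation_invariant_prob_haar_sphere)
  then interpret prob_space ?H unfolding rotation_invariant_prob_def by blast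
  have "ball e \<delta> \<inter> sphere 0 1 \<subseteq> sphere_cap \<delta> e"
  proof
    fix y assume y: "y \<in> ball e \<delta> \<inter> sphere 0 1"
    have "e \<bullet> (e - y) \<le> norm e * norm (e - y)" by (rule norm_cauchy_schwarz)
    also have "\<dots> < \<delta>" using y e by (simp add: dist_norm)
    finally have "e \<bullet> e - e \<bullet> y < \<delta>" by (simp add: inner_diff_right)
    moreover have "e \<bullet> e = 1" using e by (simp add: dot_square_norm)
    ultimately show "y \<in> sphere_cap \<delta> e" using y by (simp add: sphere_cap_def)
  qed
  then have "emeasure ?H (ball e \<delta> \<inter> sphere 0 1) \<le> emeasure ?H (sphere_cap \<delta> e)"
    by (rule emeasure_mono) (rule sphere_cap_in_sets)
  with rotation_invariant_prob_ball_pos[OF rot e \<delta>] have "0 < emeasure ?H (sphere_cap \<delta> e)"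
    by (rule less_le_trans)
  then have "0 < measure ?H (sphere_cap \<delta> e)"
    by (simp add: emeasure_eq_measure)
  then show ?thesis by (simp only: cap_measure_eq[OF e])
qed

end

theory Submission
  imports Defs
begin

text \<open>
  Averaging caps over the sphere gives a direction \<open>x\<close> in which more than \<open>8 d\<^sup>2 (m - 1)\<close> of the
  sets contain a segment whose projection has length \<open>1 - \<delta>\<close>. The endpoint pairs \<open>(p, q)\<close> of
  these segments lie in a hyperplane \<open>x \<bullet> (q - p) = 1 - \<delta>\<close> of \<open>\<real>\<^sup>2\<^sup>d\<close>, and a common point
  \<open>(p, q)\<close> of the hulls of the parts of a Tverberg partition there yields two points \<open>p\<close>, \<open>q\<close> of
  the intersection at distance at least \<open>1 - \<delta>\<close>. A weak form of Tverberg's theorem suffices: a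
  deep point, given by Helly's theorem, stays in the hull when we greedily remove \<open>m - 1\<close> sets of
  at most \<open>2 d\<close> points having it in their hull (Caratheodory in the hyperplane), which needs more
  than \<open>(2 d + 1) (2 d) (m - 1)\<close> points.
\<close>

section \<open>Deep points and a weak form of Tverberg's theorem\<close>

text \<open>Any \<open>DIM('a) + 1\<close> of the index sets \<open>R\<close> together omit at most
  \<open>(DIM('a) + 1) * s\<close> elements of \<open>J\<close>, so they share an index and their
  hulls share its point; Helly's theorem extends this to all the hulls. Points carry indices because
  \<open>w\<close> need not be injective.\<close>

lemma exists_deep_point:
  fixes w :: "'i \<Rightarrow> 'a::euclidean_space"
  assumes J: "finite J" and card: "(DIM('a) + 1) * s < card J"
  shows "\<exists>c. \<forall>R\<subseteq>J. card (J - R) \<le> s \<longrightarrow> c \<in> convex hull (w ` R)"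
proof -
  define \<R> where "\<R> = {R. R \<subseteq> J \<and> card (J - R) \<le> s}"
  define \<F> where "\<F> = (\<lambda>R. convex hull (w ` R)) ` \<R>"
  have small: "\<Inter>\<G> \<noteq> {}" if \<G>: "\<G> \<subseteq> \<F>" "card \<G> \<le> DIM('a) + 1" "finite \<G>" for \<G>
  proof -
    \<comment> \<open>Different \<open>R\<close> can have equal hulls; choosing one \<open>R\<close>
      for each hull keeps \<open>card \<Q> = card \<G>\<close>.\<close>
    obtain \<Q> where \<Q>: "\<Q> \<subseteq> \<R>" "inj_on (\<lambda>R. convex hull (w ` R)) \<Q>"
        "\<G> = (\<lambda>R. convex hull (w ` R)) ` \<Q>"
      using \<G>(1) unfolding \<F>_def subset_image_inj by blast
    have fin: "finite \<Q>" and le: "card \<Q> \<le> DIM('a) + 1"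
      using \<G>(2,3) \<Q>(2,3) by (simp_all add: finite_image_iff card_image)
    have "card (\<Union>R\<in>\<Q>. J - R) \<le> (\<Sum>R\<in>\<Q>. card (J - R))"
      using fin by (rule card_UN_le)
    also have "\<dots> \<le> card \<Q> * s"
      using \<Q>(1) by (intro sum_bounded_above[of \<Q> _ s, simplified]) (auto simp: \<R>_def)
    also have "\<dots> \<le> (DIM('a) + 1) * s"
      using le by (rule mult_right_mono) simp
    finally have "card (\<Union>R\<in>\<Q>. J - R) < card J" using card by linarith
    moreover have "finite (\<Union>R\<in>\<Q>. J - R)" using fin J by blast
    ultimately have "\<not> J \<subseteq> (\<Union>R\<in>\<Q>. J - R)"
      using card_mono not_less by blast
    then obtain j where "j \<in> J" "j \<notin> (\<Union>R\<in>\<Q>. J - R)"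
      by blast
    then have "w j \<in> convex hull (w ` R)" if "R \<in> \<Q>" for R
      using that by (intro hull_inc) auto
    then show ?thesis by (auto simp: \<Q>(3))
  qed
  have finF: "finite \<F>" unfolding \<F>_def \<R>_def using J by simp
  have "\<Inter>\<F> \<noteq> {}"
  \<comment> \<open>\<open>Helly\<close> speaks only of families with at least
    \<open>DIM('a) + 1\<close> members.\<close>
  proof (cases "card \<F> \<le> DIM('a) + 1")
    case True
    then show ?thesis using small finF by blast
  next
    case False
    show ?thesis
    proof (rule Helly)
      show "\<forall>S\<in>\<F>. convex S" by (auto simp: \<F>_def)
      show "\<Inter>t \<noteq> {}" if "t \<subseteq> \<F>" "card t = DIM('a) + 1" for t
        using small[OF that(1)] that finite_subset[OF that(1) finF] by simp
    qed (use False in simp)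
  qed
  then show ?thesis by (auto simp: \<F>_def \<R>_def)
qed

text \<open>Counting by affine dimension saves one point when the points lie in a hyperplane.
  \<open>B\<close> takes one index for each point of the Caratheodory set.\<close>

lemma caratheodory_indexed:
  fixes w :: "'i \<Rightarrow> 'a::euclidean_space"
  assumes c: "c \<in> convex hull (w ` R)" and k: "aff_dim (w ` R) < int k"
  shows "\<exists>B\<subseteq>R. card B \<le> k \<and> c \<in> convex hull (w ` B)"
proof -
  obtain S where S: "finite S" "S \<subseteq> w ` R" "card S \<le> aff_dim (w ` R) + 1" "c \<in> convex hull S"
    using c caratheodory_aff_dim[of "w ` R"] by blast
  then obtain B where "B \<subseteq> R" "inj_on w B" "S = w ` B"
    by (meson subset_image_inj)
  then show ?thesis
    using S k by (intro exI[of _ B]) (auto simp: card_image finite_image_iff)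
qed

lemma weak_Tverberg:
  fixes w :: "'i \<Rightarrow> 'a::euclidean_space"
  assumes J: "finite J" and k: "aff_dim (w ` J) < int k"
    and card: "(DIM('a) + 1) * (k * (m - 1)) < card J"
  shows "\<exists>c B. (\<forall>i\<in>{1..m}. B i \<subseteq> J \<and> c \<in> convex hull (w ` B i)) \<and> disjoint_family_on B {1..m}"
proof -
  obtain c where c: "\<And>R. R \<subseteq> J \<Longrightarrow> card (J - R) \<le> k * (m - 1) \<Longrightarrow> c \<in> convex hull (w ` R)"
    using exists_deep_point[OF J card] by blast
  \<comment> \<open>The bound on \<open>card (B i)\<close> is carried through the induction because
    it limits how many indices the earlier sets use up.\<close>
  have "\<exists>B. (\<forall>i\<in>{1..r}. B i \<subseteq> J \<and> card (B i) \<le> k \<and> c \<in> convex hull (w ` B i)) \<and>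
          disjoint_family_on B {1..r}" if "r \<le> m" for r
    using that
  proof (induction r)
    case 0
    then show ?case by (auto simp: disjoint_family_on_def)
  next
    case (Suc r)
    then obtain B where
        "\<forall>i\<in>{1..r}. B i \<subseteq> J \<and> card (B i) \<le> k \<and> c \<in> convex hull (w ` B i)"
        "disjoint_family_on B {1..r}"
      using Suc_leD[OF Suc.prems] by blast
    then have B: "\<And>i. i \<in> {1..r} \<Longrightarrow> B i \<subseteq> J" "\<And>i. i \<in> {1..r} \<Longrightarrow> card (B i) \<le> k"
        "\<And>i. i \<in> {1..r} \<Longrightarrow> c \<in> convex hull (w ` B i)" "disjoint_family_on B {1..r}"
      by blast+
    define R where "R = J - (\<Union>i\<in>{1..r}. B i)"
    have "card (J - R) \<le> card (\<Union>i\<in>{1..r}. B i)"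
    proof (rule card_mono)
      show "finite (\<Union>i\<in>{1..r}. B i)"
        using B(1) finite_subset[OF _ J] by (intro finite_UN_I) blast+
    qed (auto simp: R_def)
    also have "\<dots> \<le> (\<Sum>i\<in>{1..r}. card (B i))" by (rule card_UN_le) simp
    also have "\<dots> \<le> r * k"
      using sum_bounded_above[of "{1..r}" "\<lambda>i. card (B i)" k] B(2) by simp
    \<comment> \<open>Since \<open>Suc r \<le> m\<close>, the removed indices stay within the depth
      \<open>k * (m - 1)\<close> of \<open>c\<close>.\<close>
    also have "\<dots> \<le> (m - 1) * k" using Suc.prems by (intro mult_right_mono) auto
    finally have "c \<in> convex hull (w ` R)"
      by (intro c) (auto simp: R_def mult.commute)
    moreover have "aff_dim (w ` R) < int k"
      using aff_dim_subset[OF image_mono[of R J w]] k by (simp add: R_def)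
    ultimately obtain C where C: "C \<subseteq> R" "card C \<le> k" "c \<in> convex hull (w ` C)"
      using caratheodory_indexed by blast
    have disj: "B i \<inter> C = {}" if "i \<in> {1..r}" for i
      using C(1) that by (auto simp: R_def)
    show ?case
    proof (intro exI[of _ "B(Suc r := C)"] conjI ballI)
      show "disjoint_family_on (B(Suc r := C)) {1..Suc r}"
      proof (unfold disjoint_family_on_def, intro ballI impI)
        fix i j assume ij: "i \<in> {1..Suc r}" "j \<in> {1..Suc r}" "i \<noteq> j"
        then consider "i \<in> {1..r}" "j \<in> {1..r}" | "i = Suc r" "j \<in> {1..r}" | "i \<in> {1..r}" "j = Suc r"
          by fastforce
        then show "(B(Suc r := C)) i \<inter> (B(Suc r := C)) j = {}"
        proof cases
          case 1
          then show ?thesis using disjoint_family_onD[OF B(4) 1 ij(3)] by simp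
        next
          case 2
          then show ?thesis using disj[of j] by (simp add: Int_commute)
        next
          case 3
          then show ?thesis using disj[of i] by simp
        qed
      qed
      fix i assume "i \<in> {1..Suc r}"
      then consider "i \<in> {1..r}" | "i = Suc r" by fastforce
      then have "(B(Suc r := C)) i \<subseteq> J \<and> card ((B(Suc r := C)) i) \<le> k \<and>
          c \<in> convex hull (w ` (B(Suc r := C)) i)"
      proof cases
        case 1
        then show ?thesis using B(1-3)[of i] by simp
      next
        case 2
        then show ?thesis using C by (simp add: R_def) blast
      qed
      then show "(B(Suc r := C)) i \<subseteq> J" "card ((B(Suc r := C)) i) \<le> k"
          "c \<in> convex hull (w ` (B(Suc r := C)) i)"
        by blast+
    qed
  qed
  from this[OF order_refl] show ?thesis by blast
qed

section \<open>A direction shared by many vectors\<close>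

text \<open>
  Averaging over the sphere: since \<open>\<delta> < 1\<close>, the two caps around the directions of
  \<open>v j\<close> and \<open>- v j\<close> are disjoint, which gains a factor 2 over a single cap.
\<close>

lemma exists_common_direction:
  fixes v :: "'i \<Rightarrow> real^'d"
  assumes J: "finite J" and v: "\<And>j. j \<in> J \<Longrightarrow> v j \<noteq> 0" and \<delta>: "\<delta> < 1"
    and k: "real k < 2 * cap_measure TYPE('d) \<delta> * real (card J)"
  shows "\<exists>x\<in>sphere 0 1. k < card {j\<in>J. (1 - \<delta>) * norm (v j) \<le> \<bar>x \<bullet> v j\<bar>}"
proof (rule ccontr)
  assume contra: "\<not> ?thesis"
  let ?H = "haar_sphere :: (real^'d) measure"
  have rot: "rotation_invariant_prob ?H" by (rule rotation_invariant_prob_haar_sphere)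
  then interpret prob_space ?H unfolding rotation_invariant_prob_def by blast
  have sp: "space ?H = sphere 0 1"
    using rot sets_eq_imp_space_eq[of ?H "restrict_space borel (sphere 0 1)"]
    by (auto simp: rotation_invariant_prob_def space_restrict_space)
  define u where "u j = v j /\<^sub>R norm (v j)" for j
  have u: "u j \<in> sphere 0 1" "- u j \<in> sphere 0 1" if "j \<in> J" for j
    using v[OF that] by (auto simp: u_def)
  \<comment> \<open>The mean of \<open>g\<close> exceeds \<open>k\<close>, whereas pointwise
    \<open>g\<close> is bounded by the number of indices counted in the claim, which is at most
    \<open>k\<close> if the claim fails.\<close>
  define g :: "real^'d \<Rightarrow> real" where
    "g x = (\<Sum>j\<in>J. indicator (sphere_cap \<delta> (u j)) x + indicator (sphere_cap \<delta> (- u j)) x)" for x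
  have int_ind: "integrable ?H (indicator (sphere_cap \<delta> y) :: _ \<Rightarrow> real)" for y
    by (rule integrable_real_indicator) (auto simp: sphere_cap_in_sets emeasure_eq_measure)
  have int_g: "integrable ?H g"
    unfolding g_def by (intro Bochner_Integration.integrable_sum Bochner_Integration.integrable_add int_ind)
  have "expectation g = (\<Sum>j\<in>J. prob (sphere_cap \<delta> (u j)) + prob (sphere_cap \<delta> (- u j)))"
    unfolding g_def
    by (subst Bochner_Integration.integral_sum)
      (simp_all add: int_ind Bochner_Integration.integral_add Int_absorb1 sphere_cap_in_sets sets.sets_into_space)
  also have "\<dots> = (\<Sum>j\<in>J. 2 * cap_measure TYPE('d) \<delta>)"
    by (rule sum.cong) (simp_all only: cap_measure_eq u mult_2)
  also have "\<dots> = 2 * cap_measure TYPE('d) \<delta> * real (card J)" by simp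
  finally have "real k < expectation g" using k by simp
  moreover have "expectation g \<le> real k"
  proof (rule integral_le_const[OF int_g], rule AE_I2)
    fix x assume "x \<in> space ?H"
    then have x: "x \<in> sphere 0 1" by (simp add: sp)
    have "g x \<le> (\<Sum>j\<in>J. indicator {j\<in>J. (1 - \<delta>) * norm (v j) \<le> \<bar>x \<bullet> v j\<bar>} j)"
      unfolding g_def
    proof (rule sum_mono)
      fix j assume j: "j \<in> J"
      have "u j \<bullet> x = (x \<bullet> v j) / norm (v j)"
        by (simp add: u_def inner_commute divide_inverse mult.commute)
      then have "x \<bullet> v j = norm (v j) * (u j \<bullet> x)" using v[OF j] by simp
      then have "(1 - \<delta>) * norm (v j) \<le> \<bar>x \<bullet> v j\<bar> \<longleftrightarrow> 1 - \<delta> \<le> \<bar>u j \<bullet> x\<bar>"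
        using v[OF j] by (simp add: abs_mult mult.commute)
      then show "indicator (sphere_cap \<delta> (u j)) x + indicator (sphere_cap \<delta> (- u j)) x
          \<le> (indicator {j\<in>J. (1 - \<delta>) * norm (v j) \<le> \<bar>x \<bullet> v j\<bar>} j :: real)"
        using j \<delta> by (auto simp: indicator_def sphere_cap_def abs_if)
    qed
    also have "\<dots> = real (card {j\<in>J. (1 - \<delta>) * norm (v j) \<le> \<bar>x \<bullet> v j\<bar>})"
      using J by (simp add: indicator_def sum.If_cases Int_def)
    also have "\<dots> \<le> real k" using contra x by (auto simp: not_less)
    finally show "g x \<le> real k" .
  qed
  ultimately show False by simp
qed

section \<open>Segments with a prescribed projection, and the partition\<close>

text \<open>Shortening the segment from one end makes its projection exactly \<open>a\<close>; the
  sign of the projection decides which endpoint is kept. Exactness is what puts all endpoint pairs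
  into one hyperplane.\<close>

lemma exists_subsegment:
  fixes x :: "'a::euclidean_space"
  assumes "p \<in> S" "q \<in> S" and a: "0 < a" "a \<le> \<bar>x \<bullet> (q - p)\<bar>"
  shows "\<exists>p'\<in>convex hull S. \<exists>q'\<in>convex hull S. x \<bullet> (q' - p') = a"
proof -
  have *: "\<exists>p'\<in>convex hull S. \<exists>q'\<in>convex hull S. x \<bullet> (q' - p') = a"
    if pq: "p \<in> S" "q \<in> S" "a \<le> x \<bullet> (q - p)" for p q
  proof -
    define t where "t = a / (x \<bullet> (q - p))"
    have t: "0 \<le> t" "t \<le> 1" using a(1) pq(3) by (auto simp: t_def)
    have "(1 - t) *\<^sub>R p + t *\<^sub>R q \<in> convex hull S"
      using t pq by (intro convexD[OF convex_convex_hull] hull_inc) auto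
    moreover have "(1 - t) *\<^sub>R p + t *\<^sub>R q - p = t *\<^sub>R (q - p)"
      by (simp add: algebra_simps)
    then have "x \<bullet> ((1 - t) *\<^sub>R p + t *\<^sub>R q - p) = a"
      using a(1) pq(3) by (simp only: inner_scaleR_right t_def nonzero_eq_divide_eq) simp
    moreover have "p \<in> convex hull S" using pq(1) by (rule hull_inc)
    ultimately show ?thesis by blast
  qed
  show ?thesis
  proof (cases "0 \<le> x \<bullet> (q - p)")
    case True
    then show ?thesis using *[of p q] assms by simp
  next
    case False
    then have "a \<le> x \<bullet> (p - q)" using a by (simp add: inner_diff_right)
    then show ?thesis using *[of q p] assms by simp
  qed
qed

text \<open>A supremum need not be attained, so the sets are given actual pairs of points at
  distance at least \<open>b\<close>; the theorem uses values \<open>b < 1\<close> tending to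
  1.\<close>

lemma exists_partition_ediameter:
  fixes T :: "nat \<Rightarrow> (real^'d) set"
  assumes m: "m \<ge> 1" and \<delta>: "\<delta> < 1" and b: "0 < b"
    and n: "4 * (real CARD('d))\<^sup>2 * (real m - 1) < cap_measure TYPE('d) \<delta> * real n"
    and T: "\<And>j. j \<in> {1..n} \<Longrightarrow> \<exists>p\<in>T j. \<exists>q\<in>T j. b \<le> dist p q"
  shows "\<exists>A :: nat \<Rightarrow> nat set.
           (\<Union>i\<in>{1..m}. A i) = {1..n} \<and> disjoint_family_on A {1..m} \<and> (\<forall>i\<in>{1..m}. A i \<noteq> {}) \<and>
           ennreal ((1 - \<delta>) * b) \<le> ediameter (\<Inter>i\<in>{1..m}. convex hull (\<Union>j\<in>A i. T j))"
proof -
  define d where "d = CARD('d)"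
  have d: "1 \<le> d" by (simp add: d_def Suc_leI)
  define a where "a = (1 - \<delta>) * b"
  have a: "0 < a" using \<delta> b by (simp add: a_def)
  obtain P Q where PQ: "\<And>j. j \<in> {1..n} \<Longrightarrow> P j \<in> T j \<and> Q j \<in> T j \<and> b \<le> dist (P j) (Q j)"
    using T by metis
  \<comment> \<open>Twice the number in hypothesis \<open>n\<close>, thanks to the two caps per
    vector.\<close>
  have "real (8 * d\<^sup>2 * (m - 1)) < 2 * cap_measure TYPE('d) \<delta> * real (card {1..n})"
    using n m by (simp add: d_def mult_ac)
  moreover have "Q j - P j \<noteq> 0" if "j \<in> {1..n}" for j
    using PQ[OF that] b by auto
  ultimately obtain x where x: "x \<in> sphere 0 1"
    "8 * d\<^sup>2 * (m - 1) < card {j\<in>{1..n}. (1 - \<delta>) * norm (Q j - P j) \<le> \<bar>x \<bullet> (Q j - P j)\<bar>}"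
    using exists_common_direction[of "{1..n}" "\<lambda>j. Q j - P j" \<delta>] \<delta> by blast
  define J where "J = {j\<in>{1..n}. (1 - \<delta>) * norm (Q j - P j) \<le> \<bar>x \<bullet> (Q j - P j)\<bar>}"
  have "\<exists>p\<in>convex hull T j. \<exists>q\<in>convex hull T j. x \<bullet> (q - p) = a" if j: "j \<in> J" for j
  proof (rule exists_subsegment[OF _ _ a])
    have j': "j \<in> {1..n}" using j by (simp add: J_def)
    show "P j \<in> T j" "Q j \<in> T j" using PQ[OF j'] by auto
    have "a \<le> (1 - \<delta>) * norm (Q j - P j)"
      using PQ[OF j'] \<delta> by (simp add: a_def dist_norm norm_minus_commute)
    then show "a \<le> \<bar>x \<bullet> (Q j - P j)\<bar>" using j by (simp add: J_def)
  qed
  then obtain P' Q' where PQ': "\<And>j. j \<in> J \<Longrightarrow>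
      P' j \<in> convex hull T j \<and> Q' j \<in> convex hull T j \<and> x \<bullet> (Q' j - P' j) = a"
    by metis
  define w where "w j = (P' j, Q' j)" for j
  \<comment> \<open>On a pair \<open>(p, q)\<close> this functional is
    \<open>x \<bullet> (q - p)\<close>. As \<open>H\<close> has dimension \<open>2 * d - 1\<close>,
    Caratheodory needs only \<open>2 * d\<close> points.\<close>
  define H where "H = {z. (- x, x) \<bullet> z = a}"
  have wH: "w ` J \<subseteq> H" using PQ' by (auto simp: w_def H_def inner_diff_right)
  have x0: "x \<noteq> 0" using x(1) by auto
  have "aff_dim H = int (DIM((real^'d) \<times> (real^'d)) - 1)"
    unfolding H_def by (rule aff_dim_hyperplane) (use x0 in \<open>simp add: zero_prod_def\<close>)
  moreover have DIM2: "DIM((real^'d) \<times> (real^'d)) = 2 * d" by (simp add: d_def)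
  ultimately have "aff_dim (w ` J) < int (2 * d)"
    using aff_dim_subset[OF wH] d by linarith
  moreover have "(DIM((real^'d) \<times> (real^'d)) + 1) * (2 * d * (m - 1)) < card J"
  proof -
    \<comment> \<open>The left side is \<open>4 * d\<^sup>2 + 2 * d\<close>, and
      \<open>d \<ge> 1\<close> bounds the linear term.\<close>
    have "(2 * d + 1) * (2 * d) \<le> 8 * d\<^sup>2"
      using d by (simp add: power2_eq_square algebra_simps)
    then have "(2 * d + 1) * (2 * d) * (m - 1) \<le> 8 * d\<^sup>2 * (m - 1)"
      by (rule mult_right_mono) simp
    then show ?thesis using x(2) unfolding DIM2 J_def mult.assoc by linarith
  qed
  moreover have "finite J" by (simp add: J_def)
  ultimately obtain c B where
      "\<forall>i\<in>{1..m}. B i \<subseteq> J \<and> c \<in> convex hull (w ` B i)" "disjoint_family_on B {1..m}"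
    using weak_Tverberg[of J w "2 * d" m] by blast
  then have B: "\<And>i. i \<in> {1..m} \<Longrightarrow> B i \<subseteq> J" "\<And>i. i \<in> {1..m} \<Longrightarrow> c \<in> convex hull (w ` B i)"
      "disjoint_family_on B {1..m}"
    by blast+
  \<comment> \<open>Indices outside every \<open>B k\<close> join part 1, which can only enlarge its
    hull.\<close>
  define A where "A i = (if i = 1 then {1..n} - (\<Union>k\<in>{2..m}. B k) else B i)" for i
  have BA: "B i \<subseteq> A i" if i: "i \<in> {1..m}" for i
  proof (cases "i = 1")
    case True
    have "B 1 \<subseteq> {1..n}" using B(1)[of 1] m by (auto simp: J_def)
    moreover have "B 1 \<inter> B k = {}" if "k \<in> {2..m}" for k
      using disjoint_family_onD[OF B(3), of 1 k] that m by auto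
    ultimately show ?thesis unfolding A_def True if_P[OF refl] by blast
  qed (simp add: A_def)
  have un: "(\<Union>i\<in>{1..m}. A i) = {1..n}"
  proof
    have "A i \<subseteq> {1..n}" if "i \<in> {1..m}" for i
      using B(1)[OF that] by (auto simp: A_def J_def)
    then show "(\<Union>i\<in>{1..m}. A i) \<subseteq> {1..n}" by blast
    show "{1..n} \<subseteq> (\<Union>i\<in>{1..m}. A i)"
    proof
      fix j assume j: "j \<in> {1..n}"
      show "j \<in> (\<Union>i\<in>{1..m}. A i)"
      proof (cases "\<exists>k\<in>{2..m}. j \<in> B k")
        case True
        then obtain k where "k \<in> {2..m}" "j \<in> B k" by blast
        then show ?thesis by (intro UN_I[of k]) (auto simp: A_def)
      next
        case False
        then show ?thesis using j m by (intro UN_I[of 1]) (auto simp: A_def)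
      qed
    qed
  qed
  have disj: "disjoint_family_on A {1..m}"
  proof (unfold disjoint_family_on_def, intro ballI impI)
    fix i k assume ik: "i \<in> {1..m}" "k \<in> {1..m}" "i \<noteq> k"
    then show "A i \<inter> A k = {}"
      using disjoint_family_onD[OF B(3) ik] by (auto simp: A_def)
  qed
  have ne: "A i \<noteq> {}" if "i \<in> {1..m}" for i
    using B(2)[OF that] BA[OF that] by auto
  \<comment> \<open>Used with \<open>fst\<close> and \<open>snd\<close>: linear maps commute with
    convex hulls, so both components of \<open>c\<close> lie in the hull of every part.\<close>
  have proj: "f c \<in> convex hull (\<Union>j\<in>A i. T j)"
    if i: "i \<in> {1..m}" and f: "linear f" and fw: "\<And>j. j \<in> J \<Longrightarrow> f (w j) \<in> convex hull T j"
    for i and f :: "(real^'d) \<times> (real^'d) \<Rightarrow> real^'d"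
  proof -
    have "f c \<in> convex hull (f ` w ` B i)"
      using B(2)[OF i] convex_hull_linear_image[OF f, of "w ` B i"] by blast
    also have "\<dots> \<subseteq> convex hull (\<Union>j\<in>A i. T j)"
    proof (rule hull_minimal)
      show "f ` w ` B i \<subseteq> convex hull (\<Union>j\<in>A i. T j)"
        unfolding image_image
      proof (rule image_subsetI)
        fix j assume j: "j \<in> B i"
        then have "f (w j) \<in> convex hull T j" using B(1)[OF i] fw by blast
        moreover have "convex hull T j \<subseteq> convex hull (\<Union>j\<in>A i. T j)"
          using j BA[OF i] by (intro hull_mono) auto
        ultimately show "f (w j) \<in> convex hull (\<Union>j\<in>A i. T j)" by blast
      qed
    qed (rule convex_convex_hull)
    finally show ?thesis .
  qed
  \<comment> \<open>The hyperplane \<open>H\<close> is convex, so it contains \<open>c\<close>;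
    Cauchy-Schwarz with \<open>norm x = 1\<close> then turns the projection \<open>a\<close> into a
    distance.\<close>
  have "c \<in> convex hull (w ` B 1)" "B 1 \<subseteq> J" using B(1,2)[of 1] m by auto
  then have "c \<in> convex hull H" using wH hull_mono[of "w ` B 1" H convex] by blast
  then have "c \<in> H" by (simp add: H_def convex_hyperplane hull_same)
  then have "a = x \<bullet> (snd c - fst c)"
    by (cases c) (simp add: H_def inner_diff_right)
  also have "\<dots> \<le> norm x * norm (snd c - fst c)" by (rule norm_cauchy_schwarz)
  finally have "a \<le> dist (fst c) (snd c)"
    using x(1) by (simp add: dist_norm norm_minus_commute)
  then have "ennreal a \<le> ennreal (dist (fst c) (snd c))" by (rule ennreal_leI)
  moreover have "fst c \<in> convex hull (\<Union>j\<in>A i. T j)" if "i \<in> {1..m}" for i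
    by (rule proj[OF that linear_fst]) (simp add: w_def PQ')
  moreover have "snd c \<in> convex hull (\<Union>j\<in>A i. T j)" if "i \<in> {1..m}" for i
    by (rule proj[OF that linear_snd]) (simp add: w_def PQ')
  ultimately have "ennreal a \<le> ediameter (\<Inter>i\<in>{1..m}. convex hull (\<Union>j\<in>A i. T j))"
    unfolding ediameter_def by (intro SUP_upper2[of c]) (auto simp: mem_Times_iff case_prod_beta)
  then show ?thesis
    using un disj ne unfolding a_def by blast
qed

section \<open>The limit for diameters that are not attained\<close>

theorem theorem4p2:
  fixes T :: "nat \<Rightarrow> (real^'d) set" and m n :: nat and \<delta> :: real
  assumes "m \<ge> 1" and "0 < \<delta>" and "\<delta> < 1"
    and "n = nat \<lfloor>4 * (real CARD('d))\<^sup>2 * (real m - 1) * inverse (cap_measure TYPE('d) \<delta>)\<rfloor> + 1"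
    and "\<And>j. j \<in> {1..n} \<Longrightarrow> ediameter (T j) \<ge> 1"
  shows "\<exists>A :: nat \<Rightarrow> nat set.
           (\<Union>i\<in>{1..m}. A i) = {1..n} \<and> disjoint_family_on A {1..m} \<and> (\<forall>i\<in>{1..m}. A i \<noteq> {}) \<and>
           ediameter (\<Inter>i\<in>{1..m}. convex hull (\<Union>j\<in>A i. T j)) \<ge> ennreal (1 - \<delta>)"
proof -
  let ?K = "\<lambda>A :: nat \<Rightarrow> nat set. \<Inter>i\<in>{1..m}. convex hull (\<Union>j\<in>A i. T j)"
  let ?part = "\<lambda>A :: nat \<Rightarrow> nat set. (\<Union>i\<in>{1..m}. A i) = {1..n} \<and>
    disjoint_family_on A {1..m} \<and> (\<forall>i\<in>{1..m}. A i \<noteq> {})"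
  \<comment> \<open>The \<open>+ 1\<close> after the floor makes this strict even when the product
    is an integer.\<close>
  have "real n > 4 * (real CARD('d))\<^sup>2 * (real m - 1) * inverse (cap_measure TYPE('d) \<delta>)"
    unfolding assms(4) by linarith
  then have n: "4 * (real CARD('d))\<^sup>2 * (real m - 1) < cap_measure TYPE('d) \<delta> * real n"
    using cap_measure_pos[OF assms(2), where 'd = 'd] by (simp add: field_simps)
  \<comment> \<open>The shift by two makes already \<open>b 0 = 1 / 2\<close> positive.\<close>
  define b where "b k = 1 - inverse (real (Suc (Suc k)))" for k
  have b: "0 < b k" "b k < 1" for k by (auto simp: b_def field_simps)
  have "\<exists>A. ?part A \<and> ennreal ((1 - \<delta>) * b k) \<le> ediameter (?K A)" for k
  proof -
    have "\<exists>p\<in>T j. \<exists>q\<in>T j. b k \<le> dist p q" if j: "j \<in> {1..n}" for j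
    proof -
      have "ennreal (b k) < ennreal 1"
        using b(2)[of k] by (intro ennreal_lessI) simp_all
      also have "\<dots> \<le> ediameter (T j)"
        using assms(5)[OF j] by (simp only: ennreal_1)
      finally have "ennreal (b k) < ediameter (T j)" .
      then obtain p q where "p \<in> T j" "q \<in> T j" "ennreal (b k) < ennreal (dist p q)"
        unfolding ediameter_def less_SUP_iff by auto
      moreover from this(3) have "b k \<le> dist p q"
        using b(1)[of k] by (simp add: ennreal_less_iff)
      ultimately show ?thesis by blast
    qed
    then show ?thesis
      using exists_partition_ediameter[OF assms(1,3) b(1) n] by simp
  qed
  then obtain A where A: "\<And>k. ?part (A k)" "\<And>k. ennreal ((1 - \<delta>) * b k) \<le> ediameter (?K (A k))"
    by metis
  text \<open>Diameters need not be attained, but only finitely many partitions compete, so one of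
    them occurs for arbitrarily small losses.\<close>
  define A' where "A' k = restrict (A k) {1..m}" for k
  \<comment> \<open>Values of \<open>A k\<close> outside \<open>{1..m}\<close> are arbitrary;
    \<open>restrict\<close> fixes them, which leaves finitely many functions.\<close>
  have "range A' \<subseteq> {1..m} \<rightarrow>\<^sub>E Pow {1..n}"
    using A(1) by (fastforce simp: A'_def)
  then have "finite (range A')"
    by (rule finite_subset) (simp add: finite_PiE)
  then obtain k0 where inf: "infinite {k. A' k = A' k0}"
    using pigeonhole_infinite[of UNIV A'] by auto
  have "ennreal (1 - \<delta>) \<le> ediameter (?K (A k0))"
  proof (rule LIMSEQ_le_const2)
    \<comment> \<open>Along the infinitely many \<open>k\<close> with the same restricted partition,
      \<open>b\<close> still tends to 1.\<close>
    have "strict_mono (enumerate {k. A' k = A' k0})"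
      using inf by (rule strict_mono_enumerate)
    moreover have "b \<longlonglongrightarrow> 1 - 0"
      unfolding b_def by (intro tendsto_diff tendsto_const LIMSEQ_Suc[OF LIMSEQ_inverse_real_of_nat])
    ultimately have "(b \<circ> enumerate {k. A' k = A' k0}) \<longlonglongrightarrow> 1 - 0"
      by (intro LIMSEQ_subseq_LIMSEQ)
    then have "(\<lambda>k. (1 - \<delta>) * b (enumerate {k. A' k = A' k0} k)) \<longlonglongrightarrow> (1 - \<delta>) * (1 - 0)"
      unfolding comp_def by (intro tendsto_mult tendsto_const)
    then show "(\<lambda>k. ennreal ((1 - \<delta>) * b (enumerate {k. A' k = A' k0} k))) \<longlonglongrightarrow> ennreal (1 - \<delta>)"
      by (intro tendsto_ennrealI) simp
    have "ennreal ((1 - \<delta>) * b (enumerate {k. A' k = A' k0} k)) \<le> ediameter (?K (A k0))" for k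
    proof -
      define l where "l = enumerate {k. A' k = A' k0} k"
      have "A' l = A' k0" using enumerate_in_set[OF inf, of k] by (simp add: l_def)
      then have "A l i = A k0 i" if "i \<in> {1..m}" for i
        using that unfolding A'_def by (metis restrict_apply')
      then have "?K (A l) = ?K (A k0)" by (intro INF_cong) auto
      then show ?thesis using A(2)[of l] by (simp add: l_def)
    qed
    then show "\<exists>N. \<forall>k\<ge>N. ennreal ((1 - \<delta>) * b (enumerate {k. A' k = A' k0} k)) \<le> ediameter (?K (A k0))"
      by blast
  qed
  then show ?thesis using A(1)[of k0] by blast
qed

end
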